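(* Let $0<\lambda_p<\mu$, $\sigma\ge0$, $a,b,c>0$, $S_p>0$, $\psi=(1+\sigma^2\mu^2)/2$, and consider the two-player constrained game between service-provider (player 1) and user-set (player 2) described in the context. Let $\bar\lambda_s$ be any feasible strategy of player 2, i.e. $\bar\lambda_s\ge0$ such that the best-response problem O1 of player 1 to $\bar\lambda_s$ is feasible. Then the constrained best response dynamics started at $\bar\lambda_s$ converges in one step, because the demand constraint holds with equality in the best response problem of either player: if $(\bar\theta,\bar S_s,\bar\beta)$ is the best response of player 1 to $\bar\lambda_s$ (an optimal solution of O1), then $\bar\lambda_s=a-b\bar\theta-c\bar S_s$, and the best response of player 2 to $(\bar\theta,\bar S_s,\bar\beta)$ (the optimal solution of O2) is $a-b\bar\theta-c\bar S_s=\bar\lambda_s$. Thus a continuum of Nash equilibria $(\bar\lambda_s,\bar\theta,\bar S_s,\bar\beta)$ exists, for any feasible $\bar\lambda_s$, and these equilibria can be computed using this best response dynamics.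
   Context: Setting: a single-server M/G/1 queue with two customer classes, primary (Poisson arrival rate $\lambda_p$) and secondary (independent Poisson arrivals, rate $\lambda_s$), with i.i.d. service times of mean $1/\mu$ and variance $\sigma^2$ for both classes. The queue is operated under the non-preemptive delay dependent priority discipline with parameter $\beta\in[0,\infty]$: at each service completion the server picks the waiting customer with the highest instantaneous priority, which is (time spent waiting) times a class weight, and $\beta$ is the ratio of the secondary to the primary weight ($\beta=0$: static priority to primary; $\beta=1$: first come first served across classes; $\beta=\infty$: static priority to secondary). $W_p(\lambda_s,\beta)$ and $W_s(\lambda_s,\beta)$ denote the steady-state mean waiting times of primary and secondary customers. Explicitly, for $0\le\lambda_s<\mu-\lambda_p$ and $\lambda=\lambda_p+\lambda_s$: $W_p(\lambda_s,\beta)=\frac{\lambda\psi(\mu-\lambda(1-\beta))}{\mu(\mu-\lambda)(\mu-\lambda_p(1-\beta))}$ and $W_s(\lambda_s,\beta)=\frac{\lambda\psi}{(\mu-\lambda)(\mu-\lambda_p(1-\beta))}$ if $0\le\beta\le1$; $W_p(\lambda_s,\beta)=\frac{\lambda\psi}{(\mu-\lambda)(\mu-\lambda_s(1-1/\beta))}$ and $W_s(\lambda_s,\beta)=\frac{\lambda\psi(\mu-\lambda(1-1/\beta))}{\mu(\mu-\lambda)(\mu-\lambda_s(1-1/\beta))}$ if $1<\beta\le\infty$ (with $1/\infty=0$). At $\lambda_s=\mu-\lambda_p$ the queue is not stable and does not provide finite mean waiting times for both classes, so the constraint $\lambda_s\le\mu-\lambda_p$ below is understood to be non-binding. Game: player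 1 chooses the unit admission price $\theta$, the assured service level $S_s$ (bound on the mean waiting time) of secondary customers, and the scheduling parameter $\beta$; player 2 chooses the secondary arrival rate $\lambda_s\in\mathbb{R}_+$. $S_p$ is the given bound on the mean waiting time of primary customers. A best response of player 1 to $\bar\lambda_s$ is an optimal solution of O1: maximize $\theta\bar\lambda_s$ over $(\theta,S_s,\beta)$ subject to $W_p(\bar\lambda_s,\beta)\le S_p$, $W_s(\bar\lambda_s,\beta)\le S_s$, $\bar\lambda_s\le\mu-\lambda_p$, $\bar\lambda_s\le a-b\theta-cS_s$, $\theta,S_s\ge0$, $\beta\in[0,\infty]$. A best response of player 2 to $(\bar\theta,\bar S_s,\bar\beta)$ is an optimal solution of O2: maximize $\lambda_s$ over $\lambda_s\ge0$ subject to $\lambda_s\le a-b\bar\theta-c\bar S_s$. A tuple $(\lambda_s,\theta,S_s,\beta)$ is a Nash equilibrium if $(\theta,S_s,\beta)$ is a best response of player 1 to $\lambda_s$ and $\lambda_s$ is a best response of player 2 to $(\theta,S_s,\beta)$. The demand constraint is the constraint $\lambda_s\le a-b\theta-cS_s$ appearing in both O1 and O2.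
   Formalization: For a zero secondary arrival rate the objective is constant, so not every best response is tight; equality for every best response, one-step convergence of every run and the continuum are claimed only for a positive rate; at rate zero existence of a tight equilibrium is kept. *)

theory Defs
  imports "HOL-Analysis.Analysis"
begin

text \<open>
  \<open>lam_p\<close>: primary arrival rate; \<open>mu\<close>, \<open>sigma\<close>: service rate and standard deviation of the
  service time; \<open>S_p\<close>: bound on the mean primary waiting time; at price \<open>\<theta>\<close> and secondary
  service level \<open>S\<^sub>s\<close> the secondary demand is at most \<open>coef_a - coef_b * \<theta> - coef_c * S\<^sub>s\<close>.
\<close>

record queue_game =
  lam_p :: real
  mu :: real
  sigma :: real
  coef_a :: real
  coef_b :: real
  coef_c :: real
  S_p :: real

definition psi :: "queue_game \<Rightarrow> real" where
  "psi G = (1 + (sigma G)\<^sup>2 * (mu G)\<^sup>2) / 2"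

text \<open>
  Steady-state mean waiting times under the non-preemptive delay dependent priority
  discipline. If \<open>\<beta> = \<infinity>\<close> then \<open>1 / \<beta> = 0\<close>. When the total arrival rate reaches \<open>mu G\<close>, the two
  mean waiting times cannot both be finite; both are then set to \<open>\<infinity>\<close>, which makes
  every such arrival rate infeasible for player 1.
\<close>

definition W_p :: "queue_game \<Rightarrow> real \<Rightarrow> ereal \<Rightarrow> ereal" where
  "W_p G ls \<beta> =
    (let lam = lam_p G + ls; r = real_of_ereal \<beta>; q = real_of_ereal (1 / \<beta>) in
     if lam \<ge> mu G then \<infinity>
     else if \<beta> \<le> 1 then
       ereal (lam * psi G * (mu G - lam * (1 - r)) /
              (mu G * (mu G - lam) * (mu G - lam_p G * (1 - r))))
     else
       ereal (lam * psi G / ((mu G - lam) * (mu G - ls * (1 - q)))))"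

definition W_s :: "queue_game \<Rightarrow> real \<Rightarrow> ereal \<Rightarrow> ereal" where
  "W_s G ls \<beta> =
    (let lam = lam_p G + ls; r = real_of_ereal \<beta>; q = real_of_ereal (1 / \<beta>) in
     if lam \<ge> mu G then \<infinity>
     else if \<beta> \<le> 1 then
       ereal (lam * psi G / ((mu G - lam) * (mu G - lam_p G * (1 - r))))
     else
       ereal (lam * psi G * (mu G - lam * (1 - q)) /
              (mu G * (mu G - lam) * (mu G - ls * (1 - q)))))"

text \<open>A strategy of player 1 is a triple \<open>(\<theta>, S\<^sub>s, \<beta>)\<close>, a strategy of player 2 a rate \<open>ls\<close>.\<close>

type_synonym strategy1 = "real \<times> real \<times> ereal"

definition demand :: "queue_game \<Rightarrow> strategy1 \<Rightarrow> real" where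
  "demand G = (\<lambda>(\<theta>, Ss, \<beta>). coef_a G - coef_b G * \<theta> - coef_c G * Ss)"

definition O1_feasible :: "queue_game \<Rightarrow> real \<Rightarrow> strategy1 \<Rightarrow> bool" where
  "O1_feasible G ls = (\<lambda>(\<theta>, Ss, \<beta>).
     W_p G ls \<beta> \<le> ereal (S_p G) \<and> W_s G ls \<beta> \<le> ereal Ss \<and>
     ls \<le> mu G - lam_p G \<and> ls \<le> demand G (\<theta>, Ss, \<beta>) \<and>
     0 \<le> \<theta> \<and> 0 \<le> Ss \<and> 0 \<le> \<beta>)"

definition best_response1 :: "queue_game \<Rightarrow> real \<Rightarrow> strategy1 \<Rightarrow> bool" where
  "best_response1 G ls = is_arg_max (\<lambda>(\<theta>, Ss, \<beta>). \<theta> * ls) (O1_feasible G ls)"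

definition O2_feasible :: "queue_game \<Rightarrow> strategy1 \<Rightarrow> real \<Rightarrow> bool" where
  "O2_feasible G x ls \<longleftrightarrow> 0 \<le> ls \<and> ls \<le> demand G x"

definition best_response2 :: "queue_game \<Rightarrow> strategy1 \<Rightarrow> real \<Rightarrow> bool" where
  "best_response2 G x = is_arg_max (\<lambda>ls. ls) (O2_feasible G x)"

definition nash_eq :: "queue_game \<Rightarrow> real \<times> strategy1 \<Rightarrow> bool" where
  "nash_eq G = (\<lambda>(ls, x). best_response1 G ls x \<and> best_response2 G x ls)"

text \<open>
  A run of the dynamics from \<open>ls\<close>: in round \<open>n\<close> player 1 answers \<open>l n\<close> by some best response
  \<open>x n\<close>, and player 2 answers \<open>x n\<close> by some best response \<open>l (Suc n)\<close>.
\<close>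

definition best_response_dynamics ::
  "queue_game \<Rightarrow> real \<Rightarrow> (nat \<Rightarrow> real) \<Rightarrow> (nat \<Rightarrow> strategy1) \<Rightarrow> bool" where
  "best_response_dynamics G ls l x \<longleftrightarrow>
     l 0 = ls \<and> (\<forall>n. best_response1 G (l n) (x n) \<and> best_response2 G (x n) (l (Suc n)))"

end

theory Submission
  imports Defs
begin

text \<open>
  The ratio \<open>\<beta> \<in> [0, \<infinity>]\<close> is reparametrised by a precedence \<open>v \<in> [-1, 1]\<close> of the secondary
  class, which turns the case distinction in the waiting times into a single continuous formula.
  The secondary waiting time is strictly decreasing in \<open>v\<close>, so a best response of player 1 to
  \<open>ls > 0\<close> minimises the secondary waiting time over the compact set of admissible precedences,
  promises exactly that minimum, and charges all that the demand constraint leaves; it is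
  therefore unique. Both waiting times increase with the arrival rate, so feasibility is inherited
  by all smaller rates, which gives the continuum of equilibria.
\<close>

section \<open>The precedence scale and a common formula for the waiting times\<close>

definition precedence :: "ereal \<Rightarrow> real" where
  "precedence \<beta> = (if \<beta> \<le> 1 then real_of_ereal \<beta> - 1 else 1 - real_of_ereal (1 / \<beta>))"

text \<open>Transfers optimisation over \<beta> to a compact interval: -1 is static priority to
  primary customers, 0 first come first served, 1 static priority to secondary customers.\<close>

lemma precedence_bij: "bij_betw precedence {0..} {-1..1}"
\<comment> \<open>At \<open>v = 1\<close> the inverse gives
  \<open>1 / ereal 0 = \<infinity>\<close>, so the ratio \<infinity> is reached.\<close>
proof (rule bij_betw_byWitness[where f' = "\<lambda>v. if v \<le> 0 then ereal (1 + v) else 1 / ereal (1 - v)"])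
  show "\<forall>\<beta>\<in>{0..}. (if precedence \<beta> \<le> 0 then ereal (1 + precedence \<beta>)
          else 1 / ereal (1 - precedence \<beta>)) = \<beta>"
  proof
    fix \<beta> :: ereal assume "\<beta> \<in> {0..}"
    then show "(if precedence \<beta> \<le> 0 then ereal (1 + precedence \<beta>)
          else 1 / ereal (1 - precedence \<beta>)) = \<beta>"
      by (cases \<beta>) (auto simp: precedence_def one_ereal_def divide_ereal_def zero_ereal_def field_simps)
  qed
  show "\<forall>v\<in>{-1..1}. precedence (if v \<le> 0 then ereal (1 + v) else 1 / ereal (1 - v)) = v"
    by (auto simp: precedence_def one_ereal_def divide_ereal_def field_simps)
  show "precedence ` {0..} \<subseteq> {-1..1}"
  proof
    fix v assume "v \<in> precedence ` {0..}"
    then obtain \<beta> where "0 \<le> \<beta>" "v = precedence \<beta>" by auto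
    then show "v \<in> {-1..1}"
      by (cases \<beta>) (auto simp: precedence_def one_ereal_def divide_ereal_def field_simps)
  qed
  show "(\<lambda>v. if v \<le> 0 then ereal (1 + v) else 1 / ereal (1 - v)) ` {-1..1} \<subseteq> {0..}"
    by (auto simp: one_ereal_def divide_ereal_def zero_ereal_def)
qed

lemma precedence_range:
  assumes "0 \<le> \<beta>"
  shows "-1 \<le> precedence \<beta>" "precedence \<beta> \<le> 1"
  using bij_betwE[OF precedence_bij] assms by auto

lemma precedence_inj:
  assumes "0 \<le> \<beta>" "0 \<le> \<beta>'" "precedence \<beta> = precedence \<beta>'"
  shows "\<beta> = \<beta>'"
  using inj_onD[OF bij_betw_imp_inj_on[OF precedence_bij]] assms by auto

lemma precedence_surj:
  assumes "v \<in> {-1..1}"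
  obtains \<beta> where "0 \<le> \<beta>" "precedence \<beta> = v"
  using bij_betw_imp_surj_on[OF precedence_bij] assms by (metis atLeast_iff imageE)

text \<open>The primary waiting time has \<open>w = max 0 (- v)\<close>, the secondary one \<open>w = max 0 v\<close>.\<close>

definition wait :: "queue_game \<Rightarrow> real \<Rightarrow> real \<Rightarrow> real \<Rightarrow> real" where
  "wait G ls w v =
     psi G * ((lam_p G + ls) * (mu G - (lam_p G + ls) * w) / (mu G - (lam_p G + ls))) /
     ((mu G - lam_p G * max 0 (- v)) * (mu G - ls * max 0 v))"

lemma psi_pos: "0 < psi G"
  unfolding psi_def by (simp add: add_pos_nonneg)

section \<open>Waiting times as functions of arrival rate and precedence\<close>

locale stable_primary_game =
  fixes G :: queue_game
  assumes lam_p_pos: "0 < lam_p G"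
    and lam_p_less: "lam_p G < mu G"
    and b_pos: "0 < coef_b G"
    and c_pos: "0 < coef_c G"
begin

lemma mu_pos: "0 < mu G"
  using lam_p_pos lam_p_less by linarith

lemma scaled_less_mu:
  assumes "0 \<le> x" "x < mu G" "w \<le> 1"
  shows "x * w < mu G"
  using mult_left_le[of w x] assms by linarith

text \<open>One denominator factor of \<open>wait\<close> always equals \<open>mu G\<close>. For
  \<beta> \<le> 1 it is the \<open>mu G\<close> of the original denominator; otherwise it cancels
  against the numerator, where \<open>w = 0\<close>.\<close>

lemma W_p_eq_wait:
  assumes "lam_p G + ls < mu G" "0 \<le> \<beta>"
  shows "W_p G ls \<beta> = ereal (wait G ls (max 0 (- precedence \<beta>)) (precedence \<beta>))"
proof (cases "\<beta> \<le> 1")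
  case True
  then have "precedence \<beta> \<le> 0"
    using assms(2) by (cases \<beta>) (auto simp: precedence_def)
  with True assms mu_pos show ?thesis
    by (simp add: W_p_def wait_def Let_def precedence_def max_def mult_ac)
next
  case False
  then have "0 \<le> precedence \<beta>"
    by (cases \<beta>) (auto simp: precedence_def one_ereal_def divide_ereal_def field_simps)
  with False assms mu_pos show ?thesis
    by (simp add: W_p_def wait_def Let_def precedence_def max_def mult_ac)
qed

text \<open>The cancellation now occurs for \<beta> \<le> 1.\<close>

lemma W_s_eq_wait:
  assumes "lam_p G + ls < mu G" "0 \<le> \<beta>"
  shows "W_s G ls \<beta> = ereal (wait G ls (max 0 (precedence \<beta>)) (precedence \<beta>))"
proof (cases "\<beta> \<le> 1")
  case True
  then have "precedence \<beta> \<le> 0"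
    using assms(2) by (cases \<beta>) (auto simp: precedence_def)
  with True assms mu_pos show ?thesis
    by (simp add: W_s_def wait_def Let_def precedence_def max_def mult_ac)
next
  case False
  then have "0 \<le> precedence \<beta>"
    by (cases \<beta>) (auto simp: precedence_def one_ereal_def divide_ereal_def field_simps)
  with False assms mu_pos show ?thesis
    by (simp add: W_s_def wait_def Let_def precedence_def max_def mult_ac)
qed

lemma wait_nonneg:
  assumes "0 \<le> ls" "lam_p G + ls < mu G" "w \<le> 1" "-1 \<le> v" "v \<le> 1"
  shows "0 \<le> wait G ls w v"
proof -
  have "0 < mu G - lam_p G * max 0 (- v)" "0 < mu G - ls * max 0 v"
    "0 < mu G - (lam_p G + ls) * w"
    using assms lam_p_pos lam_p_less by (auto intro!: scaled_less_mu)
  then show ?thesis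
    using assms lam_p_pos psi_pos[of G] unfolding wait_def by simp
qed

lemma wait_mono_rate:
  assumes "0 \<le> l" "l \<le> l'" "lam_p G + l' < mu G" "0 \<le> w" "w \<le> 1" "-1 \<le> v" "v \<le> 1"
  shows "wait G l w v \<le> wait G l' w v"
proof -
  define x y where "x = lam_p G + l" and "y = lam_p G + l'"
  have xy: "0 < x" "x \<le> y" "y < mu G"
    using assms lam_p_pos by (auto simp: x_def y_def)
  \<comment> \<open>Leaves \<open>z\<close> in a single fraction with nonnegative numerator, so that
    monotonicity in \<open>z\<close> becomes visible.\<close>
  have split: "(mu G - z * w) / (mu G - z) = w + (mu G * (1 - w)) / (mu G - z)" if "z < mu G" for z
    using that by (simp add: field_simps)
  have "(mu G * (1 - w)) / (mu G - x) \<le> (mu G * (1 - w)) / (mu G - y)"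
    using xy assms mu_pos by (intro divide_left_mono) auto
  then have "(mu G - x * w) / (mu G - x) \<le> (mu G - y * w) / (mu G - y)"
    using split[of x] split[of y] xy by simp
  moreover have "0 \<le> (mu G - x * w) / (mu G - x)"
    using scaled_less_mu[of x w] xy assms by simp
  ultimately have "x * ((mu G - x * w) / (mu G - x)) \<le> y * ((mu G - y * w) / (mu G - y))"
    "0 \<le> x * ((mu G - x * w) / (mu G - x))"
    using xy by (intro mult_mono mult_nonneg_nonneg; simp)+
  then have num: "psi G * (x * (mu G - x * w) / (mu G - x)) \<le> psi G * (y * (mu G - y * w) / (mu G - y))"
    "0 \<le> psi G * (x * (mu G - x * w) / (mu G - x))"
    using psi_pos[of G] by (intro mult_left_mono mult_nonneg_nonneg; simp)+
  have "lam_p G * max 0 (- v) < mu G" "l' * max 0 v < mu G"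
    using assms lam_p_pos lam_p_less by (auto intro!: scaled_less_mu)
  moreover have "l * max 0 v \<le> l' * max 0 v"
    using assms by (simp add: mult_right_mono)
  ultimately have "0 < (mu G - lam_p G * max 0 (- v)) * (mu G - l' * max 0 v)"
    "(mu G - lam_p G * max 0 (- v)) * (mu G - l' * max 0 v)
      \<le> (mu G - lam_p G * max 0 (- v)) * (mu G - l * max 0 v)"
    by (intro mult_pos_pos mult_left_mono; simp)+
  with num show ?thesis
    unfolding wait_def x_def[symmetric] y_def[symmetric] by (intro frac_le order_trans[OF num(2,1)])
qed

text \<open>The waiting time factors as \<open>K * (A v * B v)\<close>. \<open>A\<close> falls
  strictly for negative \<open>v\<close> and is constant afterwards; \<open>B\<close> is constant
  for negative \<open>v\<close> and falls strictly afterwards.\<close>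

lemma secondary_wait_strict_antimono:
  assumes "0 \<le> ls" "lam_p G + ls < mu G" "-1 \<le> v" "v < v'" "v' \<le> 1"
  shows "wait G ls (max 0 v') v' < wait G ls (max 0 v) v"
proof -
  define x where "x = lam_p G + ls"
  define K where "K = psi G * x / (mu G - x)"
  define A where "A = (\<lambda>t. 1 / (mu G - lam_p G * max 0 (- t)))"
  define B where "B = (\<lambda>t. (mu G - x * max 0 t) / (mu G - ls * max 0 t))"
  have x: "0 < x" "x < mu G" using assms lam_p_pos by (auto simp: x_def)
  have K: "0 < K" using x psi_pos[of G] by (simp add: K_def)
  have wait_eq: "wait G ls (max 0 t) t = K * (A t * B t)" for t
    by (simp add: wait_def K_def A_def B_def x_def mult_ac)
  have pos: "0 < mu G - lam_p G * max 0 (- t)" "0 < mu G - ls * max 0 t" "0 < mu G - x * max 0 t"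
    if "-1 \<le> t" "t \<le> 1" for t
    using that assms x lam_p_pos lam_p_less by (auto intro!: scaled_less_mu)
  have AB: "0 < A t" "0 < B t" if "-1 \<le> t" "t \<le> 1" for t
    using pos[OF that] by (auto simp: A_def B_def)
  have B_less: "B t < B s" if "s \<ge> -1" "t \<le> 1" "max 0 s < max 0 t" for s t
  proof -
    have *: "-1 \<le> t" "s \<le> 1" using that by auto
    \<comment> \<open>Cross-multiplied numerator of \<open>B t - B s\<close>; it is strictly
      negative because \<open>x - ls = lam_p G > 0\<close>.\<close>
    have "(mu G - x * max 0 t) * (mu G - ls * max 0 s) - (mu G - x * max 0 s) * (mu G - ls * max 0 t)
        = - (mu G * lam_p G * (max 0 t - max 0 s))"
      unfolding x_def by algebra
    also have "\<dots> < 0" using that mu_pos lam_p_pos by simp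
    finally have "B t - B s < 0"
      using pos[of s] pos[of t] that * unfolding B_def
      by (subst diff_frac_eq) (auto intro!: divide_neg_pos mult_pos_pos)
    then show ?thesis by simp
  qed
  have A_less: "A t < A s" if "s \<ge> -1" "t \<le> 1" "max 0 (- t) < max 0 (- s)" for s t
    using pos(1)[of s] pos(1)[of t] that lam_p_pos unfolding A_def
    by (intro divide_strict_left_mono mult_pos_pos) auto
  have "A v' * B v' < A v * B v"
  proof (cases "v < 0")
    case True
    have "B v' \<le> B v"
      using B_less[of v v'] True assms by (cases "v' \<le> 0") (auto simp: B_def)
    moreover have "A v' < A v" using True assms by (intro A_less) auto
    ultimately show ?thesis
      using AB[of v] AB[of v'] assms by (intro mult_less_le_imp_less) auto
  next
    case False
    then have "B v' < B v" using assms by (intro B_less) auto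
    moreover have "A v' = A v" using False assms by (simp add: A_def)
    ultimately show ?thesis
      using AB[of v] assms by simp
  qed
  then show ?thesis using K by (simp add: wait_eq)
qed

lemma wait_continuous:
  assumes "0 \<le> ls" "lam_p G + ls < mu G"
  shows "continuous_on {-1..1} (\<lambda>v. wait G ls (max 0 (- v)) v)"
    and "continuous_on {-1..1} (\<lambda>v. wait G ls (max 0 v) v)"
proof -
  have "mu G - lam_p G * max 0 (- v) \<noteq> 0" "mu G - ls * max 0 v \<noteq> 0"
    if "v \<in> {-1..1}" for v
    using that assms lam_p_pos lam_p_less scaled_less_mu[of "lam_p G" "max 0 (- v)"]
      scaled_less_mu[of ls "max 0 v"] by auto
  then show "continuous_on {-1..1} (\<lambda>v. wait G ls (max 0 (- v)) v)"
    and "continuous_on {-1..1} (\<lambda>v. wait G ls (max 0 v) v)"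
    using assms unfolding wait_def by (auto intro!: continuous_intros)
qed

section \<open>Feasible strategies of player 1\<close>

text \<open>At an unstable rate \<open>W_p\<close> is \<infinity>, which exceeds the real bound
  \<open>S_p G\<close>.\<close>

lemma O1_feasible_stable:
  assumes "O1_feasible G ls x"
  shows "lam_p G + ls < mu G"
  using assms by (cases x) (auto simp: O1_feasible_def W_p_def Let_def split: if_splits)

lemma O1_feasible_iff:
  assumes "lam_p G + ls < mu G"
  shows "O1_feasible G ls (\<theta>, Ss, \<beta>) \<longleftrightarrow> 0 \<le> \<beta> \<and> 0 \<le> \<theta> \<and> 0 \<le> Ss \<and>
     wait G ls (max 0 (- precedence \<beta>)) (precedence \<beta>) \<le> S_p G \<and>
     wait G ls (max 0 (precedence \<beta>)) (precedence \<beta>) \<le> Ss \<and>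
     ls \<le> coef_a G - coef_b G * \<theta> - coef_c G * Ss"
  using assms W_p_eq_wait[OF assms] W_s_eq_wait[OF assms]
  by (auto simp: O1_feasible_def demand_def)

text \<open>Lowering the rate lengthens neither waiting time and relaxes the demand constraint, so
  the same strategy survives.\<close>

lemma O1_feasible_smaller_rate:
  assumes "0 \<le> l" "l \<le> l'" "O1_feasible G l' x"
  shows "O1_feasible G l x"
proof -
  obtain \<theta> Ss \<beta> where x: "x = (\<theta>, Ss, \<beta>)" by (cases x)
  have st: "lam_p G + l' < mu G" "lam_p G + l < mu G"
    using O1_feasible_stable[OF assms(3)] assms by auto
  have f: "O1_feasible G l' (\<theta>, Ss, \<beta>)" using assms(3) x by simp
  then have "0 \<le> \<beta>" using O1_feasible_iff[OF st(1)] by blast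
  note r = precedence_range[OF this]
  have "wait G l (max 0 (- precedence \<beta>)) (precedence \<beta>)
      \<le> wait G l' (max 0 (- precedence \<beta>)) (precedence \<beta>)"
    "wait G l (max 0 (precedence \<beta>)) (precedence \<beta>)
      \<le> wait G l' (max 0 (precedence \<beta>)) (precedence \<beta>)"
    using assms st r by (auto intro!: wait_mono_rate)
  with f show ?thesis
    unfolding x O1_feasible_iff[OF st(1)] O1_feasible_iff[OF st(2)] using assms(2) by auto
qed

section \<open>Best responses of player 1\<close>

lemma best_response1D:
  assumes "best_response1 G ls (\<theta>, Ss, \<beta>)"
  shows "O1_feasible G ls (\<theta>, Ss, \<beta>)"
    and "O1_feasible G ls (\<theta>', Ss', \<beta>') \<Longrightarrow> \<theta>' * ls \<le> \<theta> * ls"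
  using assms unfolding best_response1_def is_arg_max_def by (auto simp: not_less)

lemma best_response1I:
  assumes "O1_feasible G ls (\<theta>, Ss, \<beta>)"
    and "\<And>\<theta>' Ss' \<beta>'. O1_feasible G ls (\<theta>', Ss', \<beta>') \<Longrightarrow> \<theta>' * ls \<le> \<theta> * ls"
  shows "best_response1 G ls (\<theta>, Ss, \<beta>)"
  unfolding best_response1_def is_arg_max_def
proof (intro conjI)
  show "\<nexists>y. O1_feasible G ls y \<and>
       (case (\<theta>, Ss, \<beta>) of (\<theta>, Ss, \<beta>) \<Rightarrow> \<theta> * ls) < (case y of (\<theta>, Ss, \<beta>) \<Rightarrow> \<theta> * ls)"
    using assms(2) by (auto simp: not_less[symmetric])
qed (fact assms(1))

text \<open>Player 1 could adopt \<open>Ss'\<close> and \<open>\<beta>'\<close> and raise the price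
  until demand is exhausted. This deviation must not earn more, and dividing by
  \<open>ls > 0\<close> compares the prices.\<close>

lemma best_response1_binding:
  assumes "best_response1 G ls (\<theta>, Ss, \<beta>)" "0 < ls"
    and "O1_feasible G ls (\<theta>', Ss', \<beta>')"
  shows "coef_a G - coef_c G * Ss' - ls \<le> coef_b G * \<theta>"
proof -
  \<comment> \<open>The price that makes the demand constraint an equality at service level
    \<open>Ss'\<close>.\<close>
  define t where "t = (coef_a G - coef_c G * Ss' - ls) / coef_b G"
  note st = O1_feasible_stable[OF assms(3)]
  have f: "0 \<le> \<theta>'" "ls \<le> coef_a G - coef_b G * \<theta>' - coef_c G * Ss'"
    using assms(3) unfolding O1_feasible_iff[OF st] by auto
  have t: "coef_b G * t = coef_a G - coef_c G * Ss' - ls"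
    using b_pos by (simp add: t_def)
  have "\<theta>' \<le> t"
    using f b_pos by (simp add: t_def field_simps)
  then have "O1_feasible G ls (t, Ss', \<beta>')"
    using assms(3) f t unfolding O1_feasible_iff[OF st] by auto
  then have "t * ls \<le> \<theta> * ls"
    using best_response1D(2)[OF assms(1)] by blast
  then have "t \<le> \<theta>" using assms(2) by simp
  then show ?thesis using t b_pos by (metis less_imp_le mult_left_mono)
qed

text \<open>Comparing a best response with its own price-raised version gives the inequality
  opposite to feasibility.\<close>

lemma best_response1_tight:
  assumes "best_response1 G ls (\<theta>, Ss, \<beta>)" "0 < ls"
  shows "ls = coef_a G - coef_b G * \<theta> - coef_c G * Ss"
proof -
  note f = best_response1D(1)[OF assms(1)]
  show ?thesis
    using best_response1_binding[OF assms f] f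
    unfolding O1_feasible_iff[OF O1_feasible_stable[OF f]] by linarith
qed

text \<open>The service level is pinned down first, then \<beta> by strict monotonicity of the
  secondary waiting time, finally \<theta> by tightness.\<close>

lemma best_response1_unique:
  assumes "0 < ls" "best_response1 G ls x" "best_response1 G ls x'"
  shows "x = x'"
proof -
  \<comment> \<open>Replacing \<open>Ss'\<close> by the waiting time that \<open>\<beta>'\<close>
    delivers keeps the second strategy feasible; the first, being optimal and tight, cannot carry a
    larger service level.\<close>
  have key: "Ss \<le> Ss' \<and> Ss \<le> wait G ls (max 0 (precedence \<beta>')) (precedence \<beta>')"
    if "best_response1 G ls (\<theta>, Ss, \<beta>)" "best_response1 G ls (\<theta>', Ss', \<beta>')" for \<theta> Ss \<beta> \<theta>' Ss' \<beta>'
  proof -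
    note f = best_response1D(1)[OF that(2)]
    note st = O1_feasible_stable[OF f]
    let ?w = "wait G ls (max 0 (precedence \<beta>')) (precedence \<beta>')"
    have le: "?w \<le> Ss'" and "0 \<le> \<beta>'"
      using f unfolding O1_feasible_iff[OF st] by auto
    have "0 \<le> ?w"
      using assms(1) st precedence_range[OF \<open>0 \<le> \<beta>'\<close>] by (intro wait_nonneg) auto
    moreover have "coef_c G * ?w \<le> coef_c G * Ss'"
      using le c_pos by simp
    ultimately have "O1_feasible G ls (\<theta>', ?w, \<beta>')"
      using f unfolding O1_feasible_iff[OF st] by auto
    then have "coef_a G - coef_c G * ?w - ls \<le> coef_b G * \<theta>"
      by (rule best_response1_binding[OF that(1) assms(1)])
    then have "coef_c G * Ss \<le> coef_c G * ?w"
      using best_response1_tight[OF that(1) assms(1)] by linarith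
    then have "Ss \<le> ?w" using c_pos by simp
    with le show ?thesis by simp
  qed
  obtain \<theta> Ss \<beta> where x: "x = (\<theta>, Ss, \<beta>)" by (cases x)
  obtain \<theta>' Ss' \<beta>' where x': "x' = (\<theta>', Ss', \<beta>')" by (cases x')
  note br = assms(2)[unfolded x] assms(3)[unfolded x']
  note f = best_response1D(1)[OF br(1)] best_response1D(1)[OF br(2)]
  note st = O1_feasible_stable[OF f(1)]
  have Ss: "Ss = Ss'" using key[OF br] key[OF br(2,1)] by linarith
  \<comment> \<open>Comparing each best response with itself shows that its service level equals the
    waiting time it delivers.\<close>
  have w: "wait G ls (max 0 (precedence \<beta>)) (precedence \<beta>)
      = wait G ls (max 0 (precedence \<beta>')) (precedence \<beta>')"
    and nonneg: "0 \<le> \<beta>" "0 \<le> \<beta>'"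
    using key[OF br(1,1)] key[OF br(2,2)] f Ss unfolding O1_feasible_iff[OF st] by auto
  have "precedence \<beta> = precedence \<beta>'"
    using secondary_wait_strict_antimono[of ls "precedence \<beta>" "precedence \<beta>'"]
      secondary_wait_strict_antimono[of ls "precedence \<beta>'" "precedence \<beta>"]
      precedence_range[OF nonneg(1)] precedence_range[OF nonneg(2)] assms(1) st w
    by (metis less_imp_le less_irrefl linorder_neqE)
  then have "\<beta> = \<beta>'" by (rule precedence_inj[OF nonneg])
  moreover have "coef_b G * \<theta> = coef_b G * \<theta>'"
    using best_response1_tight[OF br(1) assms(1)] best_response1_tight[OF br(2) assms(1)]
    unfolding Ss by linarith
  ultimately show ?thesis using Ss b_pos by (simp add: x x')
qed

text \<open>The optimum built here exhausts demand even at \<open>ls = 0\<close>, where best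
  responses need not do so.\<close>

lemma best_response1_exists_tight:
  assumes "0 \<le> ls" "O1_feasible G ls x"
  obtains \<theta> Ss \<beta> where "best_response1 G ls (\<theta>, Ss, \<beta>)"
    "ls = coef_a G - coef_b G * \<theta> - coef_c G * Ss"
proof -
  note st = O1_feasible_stable[OF assms(2)]
  define wp ws where "wp v = wait G ls (max 0 (- v)) v" and "ws v = wait G ls (max 0 v) v" for v
  note iff = O1_feasible_iff[OF st, folded wp_def ws_def]
  \<comment> \<open>The primary bound cuts a closed subset out of [-1, 1], on which
    \<open>ws\<close> attains its minimum.\<close>
  define C where "C = {v \<in> {-1..1}. wp v \<le> S_p G}"
  have cont: "continuous_on {-1..1} wp" "continuous_on {-1..1} ws"
    using wait_continuous[OF assms(1) st] by (auto simp: wp_def[abs_def] ws_def[abs_def])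
  have "closed C" unfolding C_def
    using cont(1) by (intro continuous_on_closed_Collect_le) auto
  then have "compact C"
    using compact_Icc[of "-1::real" 1] unfolding C_def
    by (metis (no_types, lifting) closed_Int_compact inf.absorb1 mem_Collect_eq subsetI)
  obtain \<theta>0 Ss0 \<beta>0 where x: "x = (\<theta>0, Ss0, \<beta>0)" by (cases x)
  have C: "precedence \<beta> \<in> C" if "O1_feasible G ls (\<theta>, Ss, \<beta>)" for \<theta> Ss \<beta>
    using that precedence_range[of \<beta>] unfolding iff C_def by auto
  have "C \<noteq> {}" using C assms(2) x by auto
  moreover have "continuous_on C ws"
    using cont(2) by (rule continuous_on_subset) (auto simp: C_def)
  ultimately obtain v where v: "v \<in> C" "\<And>v'. v' \<in> C \<Longrightarrow> ws v \<le> ws v'"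
    using continuous_attains_inf[OF \<open>compact C\<close>] by blast
  then obtain \<beta> where \<beta>: "0 \<le> \<beta>" "precedence \<beta> = v"
    using precedence_surj[of v] by (auto simp: C_def)
  define \<theta> where "\<theta> = (coef_a G - coef_c G * ws v - ls) / coef_b G"
  have \<theta>: "coef_b G * \<theta> = coef_a G - coef_c G * ws v - ls"
    using b_pos by (simp add: \<theta>_def)
  \<comment> \<open>\<open>ws v\<close> bounds every feasible service level from below, so \<theta>
    dominates every feasible price; this yields optimality for all
    \<open>ls \<ge> 0\<close>.\<close>
  have best: "\<theta>' \<le> \<theta>" if "O1_feasible G ls (\<theta>', Ss', \<beta>')" for \<theta>' Ss' \<beta>'
  proof -
    have "ws v \<le> Ss'" using v(2)[OF C[OF that]] that unfolding iff by auto
    then have "coef_c G * ws v \<le> coef_c G * Ss'" using c_pos by simp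
    then have "coef_b G * \<theta>' \<le> coef_b G * \<theta>" using that \<theta> unfolding iff by auto
    then show ?thesis using b_pos by simp
  qed
  \<comment> \<open>Inherited from the nonnegative price of the given feasible strategy
    \<open>x\<close>.\<close>
  have "0 \<le> \<theta>" using best[OF assms(2)[unfolded x]] assms(2) unfolding x iff by auto
  moreover have "0 \<le> ws v"
    using v(1) assms(1) st unfolding ws_def C_def by (intro wait_nonneg) auto
  ultimately have f: "O1_feasible G ls (\<theta>, ws v, \<beta>)"
    using \<beta> v(1) \<theta> unfolding iff C_def by auto
  show ?thesis
  proof
    show "best_response1 G ls (\<theta>, ws v, \<beta>)"
      using f best assms(1) by (auto intro!: best_response1I mult_right_mono)
    show "ls = coef_a G - coef_b G * \<theta> - coef_c G * ws v" using \<theta> by simp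
  qed
qed

section \<open>Best responses of player 2 and equilibria\<close>

text \<open>Player 2 maximises the identity over the interval from 0 to the demand, which is
  nonempty since it contains \<open>ls\<close>.\<close>

lemma best_response2_iff:
  assumes "0 \<le> ls" "ls \<le> coef_a G - coef_b G * \<theta> - coef_c G * Ss"
  shows "best_response2 G (\<theta>, Ss, \<beta>) l \<longleftrightarrow> l = coef_a G - coef_b G * \<theta> - coef_c G * Ss"
proof -
  define d where "d = coef_a G - coef_b G * \<theta> - coef_c G * Ss"
  have "0 \<le> d" using assms by (simp add: d_def)
  then have "best_response2 G (\<theta>, Ss, \<beta>) l \<longleftrightarrow> l = d"
    unfolding best_response2_def is_arg_max_def O2_feasible_def demand_def prod.case d_def[symmetric]
    by (metis eq_iff not_le)
  then show ?thesis by (simp add: d_def)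
qed

lemma best_response2_to_best_response1:
  assumes "0 \<le> ls" "best_response1 G ls (\<theta>, Ss, \<beta>)"
  shows "best_response2 G (\<theta>, Ss, \<beta>) l \<longleftrightarrow> l = coef_a G - coef_b G * \<theta> - coef_c G * Ss"
proof -
  note f = best_response1D(1)[OF assms(2)]
  show ?thesis
    using f unfolding O1_feasible_iff[OF O1_feasible_stable[OF f]]
    by (intro best_response2_iff[OF assms(1)]) auto
qed

text \<open>By tightness, the demand with which player 2 answers is \<open>ls\<close>
  itself.\<close>

lemma best_response1_nash:
  assumes "0 < ls" "best_response1 G ls x"
  shows "best_response2 G x l \<longleftrightarrow> l = ls" and "nash_eq G (ls, x)"
proof -
  show *: "best_response2 G x l \<longleftrightarrow> l = ls" for l
    using best_response2_to_best_response1[of ls] best_response1_tight[of ls] assms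
    by (cases x) auto
  show "nash_eq G (ls, x)" using * assms(2) by (simp add: nash_eq_def)
qed

lemma nash_exists:
  assumes "0 \<le> ls" "O1_feasible G ls x"
  obtains \<theta> Ss \<beta> where "best_response1 G ls (\<theta>, Ss, \<beta>)"
    "ls = coef_a G - coef_b G * \<theta> - coef_c G * Ss" "nash_eq G (ls, \<theta>, Ss, \<beta>)"
proof -
  obtain \<theta> Ss \<beta> where *: "best_response1 G ls (\<theta>, Ss, \<beta>)"
    "ls = coef_a G - coef_b G * \<theta> - coef_c G * Ss"
    using best_response1_exists_tight[OF assms] .
  then have "nash_eq G (ls, \<theta>, Ss, \<beta>)"
    using best_response2_to_best_response1[OF assms(1) *(1)] by (simp add: nash_eq_def)
  then show ?thesis using that * by blast
qed

section \<open>Best response dynamics and the continuum of equilibria\<close>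

text \<open>Player 2 always returns \<open>ls\<close>, so player 1 faces the same problem in every
  round and uniqueness makes its replies constant.\<close>

lemma best_response_dynamics_stationary:
  assumes "0 < ls" "best_response_dynamics G ls l x"
  shows "l n = ls" "x n = x 0" "nash_eq G (l n, x n)"
proof -
  have br: "best_response1 G (l n) (x n)" "best_response2 G (x n) (l (Suc n))" for n
    using assms(2) by (auto simp: best_response_dynamics_def)
  have l: "l n = ls" for n
  proof (induction n)
    case 0
    show ?case using assms(2) by (simp add: best_response_dynamics_def)
  next
    case (Suc n)
    then show ?case using br[of n] best_response1_nash(1)[OF assms(1)] by auto
  qed
  show "l n = ls" by (rule l)
  show "x n = x 0"
    using br(1)[of n] br(1)[of 0] l best_response1_unique[OF assms(1)] by auto
  show "nash_eq G (l n, x n)"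
    using br(1)[of n] l best_response1_nash(2)[OF assms(1)] by auto
qed

lemma continuum_of_nash:
  assumes "0 < ls" "O1_feasible G ls x"
  shows "{0..ls} \<subseteq> {l. \<exists>x. nash_eq G (l, x)}" "uncountable {z. nash_eq G z}"
proof -
  show *: "{0..ls} \<subseteq> {l. \<exists>x. nash_eq G (l, x)}"
  proof
    fix l assume "l \<in> {0..ls}"
    then have "0 \<le> l" "O1_feasible G l x"
      using O1_feasible_smaller_rate[OF _ _ assms(2)] by auto
    then show "l \<in> {l. \<exists>x. nash_eq G (l, x)}" by (blast elim: nash_exists)
  qed
  \<comment> \<open>The rates of the equilibria cover a nondegenerate interval, which countably many
    equilibria could not do.\<close>
  have "{0..ls} \<subseteq> fst ` {z. nash_eq G z}" using * by force
  moreover have "uncountable {0..ls}" using assms(1) by (simp add: uncountable_closed_interval)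
  ultimately show "uncountable {z. nash_eq G z}"
    using countable_image countable_subset by blast
qed

end

text \<open>At rate 0 revenue vanishes, every feasible strategy is optimal and demand may stay
  slack; hence \<open>0 < ls\<close> where all best responses are claimed tight or all runs
  stationary.\<close>

theorem mainTheorem3:
  fixes G :: queue_game and ls :: real
  assumes "0 < lam_p G" and "lam_p G < mu G" and "0 \<le> sigma G"
    and "0 < coef_a G" and "0 < coef_b G" and "0 < coef_c G" and "0 < S_p G"
    and "0 \<le> ls" and "\<exists>x. O1_feasible G ls x"
  shows
    "(\<forall>\<theta> Ss \<beta>. best_response1 G ls (\<theta>, Ss, \<beta>) \<longrightarrow>
        (\<forall>l. best_response2 G (\<theta>, Ss, \<beta>) l \<longleftrightarrow> l = coef_a G - coef_b G * \<theta> - coef_c G * Ss) \<and>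
        (0 < ls \<longrightarrow> ls = coef_a G - coef_b G * \<theta> - coef_c G * Ss \<and>
                  nash_eq G (ls, \<theta>, Ss, \<beta>)))
     \<and> (0 < ls \<longrightarrow> (\<forall>l x. best_response_dynamics G ls l x \<longrightarrow>
          (\<forall>n. l n = ls \<and> x n = x 0 \<and> nash_eq G (l n, x n))))
     \<and> (\<exists>\<theta> Ss \<beta>. best_response1 G ls (\<theta>, Ss, \<beta>) \<and>
          ls = coef_a G - coef_b G * \<theta> - coef_c G * Ss \<and>
          best_response_dynamics G ls (\<lambda>_. ls) (\<lambda>_. (\<theta>, Ss, \<beta>)) \<and>
          nash_eq G (ls, \<theta>, Ss, \<beta>))
     \<and> (0 < ls \<longrightarrow> {0..ls} \<subseteq> {l. \<exists>x. nash_eq G (l, x)} \<and> uncountable {z. nash_eq G z})"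
proof -
  interpret stable_primary_game G using assms by unfold_locales
  obtain x where x: "O1_feasible G ls x" using assms by blast
  obtain \<theta>0 Ss0 \<beta>0 where ne: "best_response1 G ls (\<theta>0, Ss0, \<beta>0)"
    "ls = coef_a G - coef_b G * \<theta>0 - coef_c G * Ss0" "nash_eq G (ls, \<theta>0, Ss0, \<beta>0)"
    using nash_exists[OF \<open>0 \<le> ls\<close> x] .
  then have "best_response_dynamics G ls (\<lambda>_. ls) (\<lambda>_. (\<theta>0, Ss0, \<beta>0))"
    by (simp add: best_response_dynamics_def nash_eq_def)
  with ne have "\<exists>\<theta> Ss \<beta>. best_response1 G ls (\<theta>, Ss, \<beta>) \<and>
          ls = coef_a G - coef_b G * \<theta> - coef_c G * Ss \<and>
          best_response_dynamics G ls (\<lambda>_. ls) (\<lambda>_. (\<theta>, Ss, \<beta>)) \<and>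
          nash_eq G (ls, \<theta>, Ss, \<beta>)"
    by blast
  moreover have "\<forall>\<theta> Ss \<beta>. best_response1 G ls (\<theta>, Ss, \<beta>) \<longrightarrow>
        (\<forall>l. best_response2 G (\<theta>, Ss, \<beta>) l \<longleftrightarrow> l = coef_a G - coef_b G * \<theta> - coef_c G * Ss) \<and>
        (0 < ls \<longrightarrow> ls = coef_a G - coef_b G * \<theta> - coef_c G * Ss \<and>
                  nash_eq G (ls, \<theta>, Ss, \<beta>))"
    using best_response2_to_best_response1[OF \<open>0 \<le> ls\<close>] best_response1_tight
      best_response1_nash(2) by blast
  moreover have "0 < ls \<longrightarrow> (\<forall>l x. best_response_dynamics G ls l x \<longrightarrow>
          (\<forall>n. l n = ls \<and> x n = x 0 \<and> nash_eq G (l n, x n)))"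
    using best_response_dynamics_stationary by blast
  moreover have "0 < ls \<longrightarrow> {0..ls} \<subseteq> {l. \<exists>x. nash_eq G (l, x)} \<and> uncountable {z. nash_eq G z}"
    using continuum_of_nash[OF _ x] by blast
  ultimately show ?thesis by blast
qed

end
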